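(* Let $(V,q)$ be a quadratic space over $\mathbb{K}$ such that $V^\times := \{x\in V \mid q(x)\in\mathbb{K}^\times\}$ is non-empty. Then $M=V^\times$ carries the following three well-defined product maps $V^\times\times V^\times\to V^\times$, each of which satisfies the axioms (S1), (S2), (S3) of a reflection space: \begin{enumerate} \item $(x,y)\mapsto s_x(y)=\frac{b_q(y,x)}{q(x)}\,x-y$; \item $(x,y)\mapsto j_x(y)=\frac{q(x)}{q(y)}\,y$; \item $(x,y)\mapsto \sigma_x(y)=\frac{b_q(y,x)}{q(y)}\,x-\frac{q(x)}{q(y)}\,y$. \end{enumerate} All three maps restrict to every sphere $S=\{x\in V\mid q(x)=r\}$ with $r\in\mathbb{K}^\times$ (that is, $S$ is stable under each of the three products), so that $S$ becomes a sub-reflection space of $V^\times$. For $j$ these restrictions to spheres are trivial (i.e. $j_x(y)=y$ for $x,y\in S$), and for $s$ and $\sigma$ the restrictions to spheres coincide.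
   Context: $\mathbb{K}$ is a commutative ring with unit $1$ ($2$ is not assumed invertible). A quadratic space $(V,q)$ is a $\mathbb{K}$-module $V$ with a map $q:V\to\mathbb{K}$ such that $q(\lambda v)=\lambda^2q(v)$ for all $\lambda\in\mathbb{K}$, $v\in V$, and such that $b_q(u,v):=q(u+v)-q(u)-q(v)$ is $\mathbb{K}$-bilinear ($q$ may be degenerate). A reflection space is a set $M$ with a map $M\times M\to M$, $(x,y)\mapsto \sigma_x(y)$, such that for all $x,y\in M$: (S1) $\sigma_x(x)=x$; (S2) $\sigma_x\circ\sigma_x=\mathrm{id}$; (S3) $\sigma_x\circ\sigma_y\circ\sigma_x=\sigma_{\sigma_x(y)}$. *)

theory Defs
  imports "HOL-Algebra.Module"
begin

definition bilinear_form ::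
  "('a, 'r) ring_scheme \<Rightarrow> ('a, 'v, 'm) module_scheme \<Rightarrow> ('v \<Rightarrow> 'v \<Rightarrow> 'a) \<Rightarrow> bool"
where
  "bilinear_form R V b \<longleftrightarrow>
     (\<forall>u\<in>carrier V. \<forall>v\<in>carrier V. b u v \<in> carrier R) \<and>
     (\<forall>u\<in>carrier V. \<forall>v\<in>carrier V. \<forall>w\<in>carrier V.
        b (u \<oplus>\<^bsub>V\<^esub> v) w = b u w \<oplus>\<^bsub>R\<^esub> b v w \<and>
        b w (u \<oplus>\<^bsub>V\<^esub> v) = b w u \<oplus>\<^bsub>R\<^esub> b w v) \<and>
     (\<forall>l\<in>carrier R. \<forall>u\<in>carrier V. \<forall>v\<in>carrier V.
        b (l \<odot>\<^bsub>V\<^esub> u) v = l \<otimes>\<^bsub>R\<^esub> b u v \<and>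
        b u (l \<odot>\<^bsub>V\<^esub> v) = l \<otimes>\<^bsub>R\<^esub> b u v)"

definition polar_form ::
  "('a, 'r) ring_scheme \<Rightarrow> ('a, 'v, 'm) module_scheme \<Rightarrow> ('v \<Rightarrow> 'a) \<Rightarrow> 'v \<Rightarrow> 'v \<Rightarrow> 'a"
where
  "polar_form R V q u v = q (u \<oplus>\<^bsub>V\<^esub> v) \<ominus>\<^bsub>R\<^esub> q u \<ominus>\<^bsub>R\<^esub> q v"

text \<open>The zero ring is not excluded, 2 need not be invertible, and the form may be degenerate.\<close>

locale quadratic_space = module R V
  for R :: "('a, 'r) ring_scheme" (structure)
    and V :: "('a, 'v, 'm) module_scheme" (structure) +
  fixes q :: "'v \<Rightarrow> 'a"
  assumes q_closed: "v \<in> carrier V \<Longrightarrow> q v \<in> carrier R"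
    and q_smult: "l \<in> carrier R \<Longrightarrow> v \<in> carrier V \<Longrightarrow>
      q (l \<odot>\<^bsub>V\<^esub> v) = l [^]\<^bsub>R\<^esub> (2::nat) \<otimes>\<^bsub>R\<^esub> q v"
    and polar_bilinear: "bilinear_form R V (polar_form R V q)"

definition unit_vectors ::
  "('a, 'r) ring_scheme \<Rightarrow> ('a, 'v, 'm) module_scheme \<Rightarrow> ('v \<Rightarrow> 'a) \<Rightarrow> 'v set"
where
  "unit_vectors R V q = {x \<in> carrier V. q x \<in> Units R}"

definition q_sphere :: "('a, 'v, 'm) module_scheme \<Rightarrow> ('v \<Rightarrow> 'a) \<Rightarrow> 'a \<Rightarrow> 'v set"
where
  "q_sphere V q r = {x \<in> carrier V. q x = r}"

text \<open>The product is a function on the whole type, but only its values on \<open>M \<times> M\<close> matter.\<close>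

locale reflection_space =
  fixes M :: "'v set" and \<sigma> :: "'v \<Rightarrow> 'v \<Rightarrow> 'v"
  assumes closed: "x \<in> M \<Longrightarrow> y \<in> M \<Longrightarrow> \<sigma> x y \<in> M"
    and S1: "x \<in> M \<Longrightarrow> \<sigma> x x = x"
    and S2: "x \<in> M \<Longrightarrow> y \<in> M \<Longrightarrow> \<sigma> x (\<sigma> x y) = y"
    and S3: "x \<in> M \<Longrightarrow> y \<in> M \<Longrightarrow> z \<in> M \<Longrightarrow>
      \<sigma> x (\<sigma> y (\<sigma> x z)) = \<sigma> (\<sigma> x y) z"

definition sub_reflection_space :: "'v set \<Rightarrow> 'v set \<Rightarrow> ('v \<Rightarrow> 'v \<Rightarrow> 'v) \<Rightarrow> bool"
where
  "sub_reflection_space S M \<sigma> \<longleftrightarrow>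
     reflection_space M \<sigma> \<and> S \<subseteq> M \<and> (\<forall>x\<in>S. \<forall>y\<in>S. \<sigma> x y \<in> S)"

lemma sub_reflection_space_imp_reflection_space:
  assumes "sub_reflection_space S M \<sigma>"
  shows "reflection_space S \<sigma>"
proof -
  interpret reflection_space M \<sigma>
    using assms by (simp add: sub_reflection_space_def)
  from assms have sub: "\<And>x. x \<in> S \<Longrightarrow> x \<in> M"
    and stable: "\<And>x y. x \<in> S \<Longrightarrow> y \<in> S \<Longrightarrow> \<sigma> x y \<in> S"
    by (auto simp: sub_reflection_space_def)
  show ?thesis
    by unfold_locales (simp_all add: sub stable S1 S2 S3)
qed

text \<open>In the following products a quotient \<open>a / c\<close> is rendered as \<open>a\<close> times the inverse of \<open>c\<close>
  in \<open>R\<close>; it is meaningful only when \<open>c\<close> is a unit.\<close>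

definition s_prod ::
  "('a, 'r) ring_scheme \<Rightarrow> ('a, 'v, 'm) module_scheme \<Rightarrow> ('v \<Rightarrow> 'a) \<Rightarrow> 'v \<Rightarrow> 'v \<Rightarrow> 'v"
where
  "s_prod R V q x y =
     (polar_form R V q y x \<otimes>\<^bsub>R\<^esub> inv\<^bsub>R\<^esub> (q x)) \<odot>\<^bsub>V\<^esub> x \<ominus>\<^bsub>V\<^esub> y"

definition j_prod ::
  "('a, 'r) ring_scheme \<Rightarrow> ('a, 'v, 'm) module_scheme \<Rightarrow> ('v \<Rightarrow> 'a) \<Rightarrow> 'v \<Rightarrow> 'v \<Rightarrow> 'v"
where
  "j_prod R V q x y = (q x \<otimes>\<^bsub>R\<^esub> inv\<^bsub>R\<^esub> (q y)) \<odot>\<^bsub>V\<^esub> y"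

definition sigma_prod ::
  "('a, 'r) ring_scheme \<Rightarrow> ('a, 'v, 'm) module_scheme \<Rightarrow> ('v \<Rightarrow> 'a) \<Rightarrow> 'v \<Rightarrow> 'v \<Rightarrow> 'v"
where
  "sigma_prod R V q x y =
     (polar_form R V q y x \<otimes>\<^bsub>R\<^esub> inv\<^bsub>R\<^esub> (q y)) \<odot>\<^bsub>V\<^esub> x
       \<ominus>\<^bsub>V\<^esub> (q x \<otimes>\<^bsub>R\<^esub> inv\<^bsub>R\<^esub> (q y)) \<odot>\<^bsub>V\<^esub> y"

end

theory Submission
  imports Defs
begin

text \<open>Each \<open>s_x\<close> is a linear isometric involution that is self-adjoint for the polar form and depends
  only on the line through \<open>x\<close>. The other two products arise from \<open>p_x = id\<close> and \<open>p_x = s_x\<close>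
  respectively by the rescaling \<open>(x, y) \<mapsto> (q(x) / q(y)) p_x(y)\<close>, which turns any
  reflection space with isometric, homogeneous \<open>p_x\<close> depending only on the line through \<open>x\<close>
  into another one.\<close>

section \<open>Auxiliary facts on inverses, modules and reflection spaces\<close>

lemma (in comm_monoid) inv_mult_Units:
  assumes "a \<in> Units G" "b \<in> Units G"
  shows "inv (a \<otimes> b) = inv a \<otimes> inv b"
proof (rule comm_inv_char)
  have "a \<otimes> b \<otimes> (inv a \<otimes> inv b) = (a \<otimes> inv a) \<otimes> (b \<otimes> inv b)"
    using assms by (simp add: m_ac Units_closed del: Units_r_inv Units_l_inv)
  then show "a \<otimes> b \<otimes> (inv a \<otimes> inv b) = \<one>"
    using assms by simp
qed (use assms in auto)

lemma (in module) smult_minus_distr: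
  assumes "a \<in> carrier R" "x \<in> carrier M" "y \<in> carrier M"
  shows "a \<odot>\<^bsub>M\<^esub> (x \<ominus>\<^bsub>M\<^esub> y) = a \<odot>\<^bsub>M\<^esub> x \<ominus>\<^bsub>M\<^esub> a \<odot>\<^bsub>M\<^esub> y"
  using assms by (simp add: M.minus_eq smult_r_distr smult_r_minus)

lemma (in abelian_group) minus_minus_cancel:
  assumes "x \<in> carrier G" "y \<in> carrier G"
  shows "x \<ominus> (x \<ominus> y) = y"
  using assms by (simp add: minus_eq minus_add a_assoc[symmetric] r_neg)

text \<open>Needed because the formula for \<open>sigma_prod\<close> agrees with its rescaled form
  only on unit vectors, where the inverses make sense, and not as a function on the whole
  type.\<close>

lemma reflection_space_cong:
  assumes "reflection_space M p" "\<And>x y. x \<in> M \<Longrightarrow> y \<in> M \<Longrightarrow> p' x y = p x y"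
  shows "reflection_space M p'"
proof -
  interpret reflection_space M p by fact
  show ?thesis
    by unfold_locales (simp_all add: assms(2) closed S1 S2 S3)
qed

section \<open>Calculus of the polar form\<close>

context quadratic_space
begin

abbreviation b :: "'v \<Rightarrow> 'v \<Rightarrow> 'a" where "b \<equiv> polar_form R V q"
abbreviation U :: "'v set" where "U \<equiv> unit_vectors R V q"

lemma polar_closed [simp]: "u \<in> carrier V \<Longrightarrow> v \<in> carrier V \<Longrightarrow> b u v \<in> carrier R"
  using polar_bilinear by (auto simp: bilinear_form_def)

lemma polar_add_left:
  "\<lbrakk>u \<in> carrier V; v \<in> carrier V; w \<in> carrier V\<rbrakk> \<Longrightarrow> b (u \<oplus>\<^bsub>V\<^esub> v) w = b u w \<oplus> b v w"
  using polar_bilinear by (auto simp: bilinear_form_def)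

lemma polar_smult_left:
  "\<lbrakk>l \<in> carrier R; u \<in> carrier V; v \<in> carrier V\<rbrakk> \<Longrightarrow> b (l \<odot>\<^bsub>V\<^esub> u) v = l \<otimes> b u v"
  using polar_bilinear by (auto simp: bilinear_form_def)

lemma polar_sym: "u \<in> carrier V \<Longrightarrow> v \<in> carrier V \<Longrightarrow> b u v = b v u"
  unfolding polar_form_def using q_closed[of u] q_closed[of v] q_closed[of "u \<oplus>\<^bsub>V\<^esub> v"]
  by (simp add: M.a_comm[of u v] R.minus_eq R.a_ac)

lemma polar_minus_left:
  assumes "u \<in> carrier V" "v \<in> carrier V"
  shows "b (\<ominus>\<^bsub>V\<^esub> u) v = \<ominus> b u v"
proof -
  have "\<ominus>\<^bsub>V\<^esub> u = (\<ominus> \<one>) \<odot>\<^bsub>V\<^esub> u" using assms by (simp add: smult_l_minus)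
  then show ?thesis using assms by (simp add: polar_smult_left R.l_minus)
qed

lemma polar_diff_left:
  "\<lbrakk>u \<in> carrier V; v \<in> carrier V; w \<in> carrier V\<rbrakk> \<Longrightarrow> b (u \<ominus>\<^bsub>V\<^esub> v) w = b u w \<ominus> b v w"
  by (simp add: M.minus_eq R.minus_eq polar_add_left polar_minus_left)

lemma polar_smult_right:
  "\<lbrakk>l \<in> carrier R; u \<in> carrier V; v \<in> carrier V\<rbrakk> \<Longrightarrow> b u (l \<odot>\<^bsub>V\<^esub> v) = l \<otimes> b u v"
  by (simp add: polar_sym[of u] polar_smult_left)

lemma polar_diff_right:
  "\<lbrakk>u \<in> carrier V; v \<in> carrier V; w \<in> carrier V\<rbrakk> \<Longrightarrow> b w (u \<ominus>\<^bsub>V\<^esub> v) = b w u \<ominus> b w v"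
  by (simp add: polar_sym[of w] polar_diff_left)

lemma q_add:
  assumes "u \<in> carrier V" "v \<in> carrier V"
  shows "q (u \<oplus>\<^bsub>V\<^esub> v) = b u v \<oplus> q u \<oplus> q v"
proof -
  have "q u \<in> carrier R" "q v \<in> carrier R" "q (u \<oplus>\<^bsub>V\<^esub> v) \<in> carrier R"
    using assms by (auto intro: q_closed)
  then show ?thesis unfolding polar_form_def by algebra
qed

lemma q_minus: "u \<in> carrier V \<Longrightarrow> q (\<ominus>\<^bsub>V\<^esub> u) = q u"
proof -
  assume u: "u \<in> carrier V"
  have "\<ominus>\<^bsub>V\<^esub> u = (\<ominus> \<one>) \<odot>\<^bsub>V\<^esub> u" using u by (simp add: smult_l_minus)
  then show ?thesis using u q_closed[of u]
    by (simp add: q_smult numeral_2_eq_2 R.l_minus R.r_minus)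
qed

lemma q_diff:
  assumes "u \<in> carrier V" "v \<in> carrier V"
  shows "q (u \<ominus>\<^bsub>V\<^esub> v) = q u \<oplus> q v \<ominus> b u v"
proof -
  have "q u \<in> carrier R" "q v \<in> carrier R" "b u v \<in> carrier R"
    using assms by (auto intro: q_closed)
  moreover have "b u (\<ominus>\<^bsub>V\<^esub> v) = \<ominus> b u v"
    using assms by (simp add: polar_sym[of u] polar_minus_left)
  ultimately show ?thesis
    using assms by (simp add: M.minus_eq q_add q_minus R.minus_eq R.a_ac)
qed

text \<open>Homogeneity at the scalar 2 gives q(u + u) = 4 q(u), and the definition of the polar
  form subtracts two copies of q(u). Nothing is divided by 2.\<close>

lemma polar_self: "u \<in> carrier V \<Longrightarrow> b u u = q u \<oplus> q u"
proof -
  assume u: "u \<in> carrier V"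
  have qu: "q u \<in> carrier R" using u by (rule q_closed)
  have "u \<oplus>\<^bsub>V\<^esub> u = (\<one> \<oplus> \<one>) \<odot>\<^bsub>V\<^esub> u" using u by (simp add: smult_l_distr)
  then have "q (u \<oplus>\<^bsub>V\<^esub> u) = (\<one> \<oplus> \<one>) \<otimes> (\<one> \<oplus> \<one>) \<otimes> q u"
    using u by (simp add: q_smult numeral_2_eq_2)
  then have "b u u = (\<one> \<oplus> \<one>) \<otimes> (\<one> \<oplus> \<one>) \<otimes> q u \<ominus> q u \<ominus> q u"
    by (simp add: polar_form_def)
  also have "\<dots> = q u \<oplus> q u" using qu R.one_closed by algebra
  finally show ?thesis .
qed

section \<open>Unit vectors and the reflections s_x\<close>

lemma unit_vectorsI: "x \<in> carrier V \<Longrightarrow> q x \<in> Units R \<Longrightarrow> x \<in> U"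
  by (simp add: unit_vectors_def)

lemma unit_vectors_closed [simp]: "x \<in> U \<Longrightarrow> x \<in> carrier V"
  and unit_vectors_q [simp]: "x \<in> U \<Longrightarrow> q x \<in> Units R"
  by (auto simp: unit_vectors_def)

lemma smult_unit_vectors:
  "l \<in> Units R \<Longrightarrow> x \<in> U \<Longrightarrow> l \<odot>\<^bsub>V\<^esub> x \<in> U"
  by (rule unit_vectorsI) (simp_all add: q_smult R.Units_closed numeral_2_eq_2)

lemma s_prod_closed [simp]:
  "x \<in> U \<Longrightarrow> y \<in> carrier V \<Longrightarrow> s_prod R V q x y \<in> carrier V"
  by (simp add: s_prod_def)

text \<open>For c = b(y,x)/q(x), expanding q(c x - y) gives c^2 q(x) + q(y) - c b(y,x); since c q(x)
  = b(y,x), the outer terms cancel.\<close>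

lemma q_s_prod:
  assumes "x \<in> U" "y \<in> carrier V"
  shows "q (s_prod R V q x y) = q y"
proof -
  define c where "c = b y x \<otimes> inv (q x)"
  have c: "c \<in> carrier R" "c \<otimes> q x = b y x"
    using assms by (simp_all add: c_def R.m_assoc R.Units_closed)
  have "q (c \<odot>\<^bsub>V\<^esub> x \<ominus>\<^bsub>V\<^esub> y) = c \<otimes> c \<otimes> q x \<oplus> q y \<ominus> c \<otimes> b y x"
    using assms c by (simp add: q_diff q_smult polar_smult_left polar_sym[of x y] numeral_2_eq_2)
  also have "c \<otimes> c \<otimes> q x = c \<otimes> b y x"
    using assms c by (simp add: R.m_assoc R.Units_closed)
  also have "c \<otimes> b y x \<oplus> q y \<ominus> c \<otimes> b y x = q y"
    using c(1) polar_closed[of y x] q_closed[of y] assms unit_vectors_closed by algebra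
  finally show ?thesis by (simp add: s_prod_def c_def)
qed

text \<open>As b(x,x) = 2 q(x), the multiple of x contributes 2 b(y,x). Consequently y and its image
  have the same coefficient of x in the formula for s_x, which is what makes s_x an
  involution.\<close>

lemma polar_s_prod_self:
  assumes "x \<in> U" "y \<in> carrier V"
  shows "b (s_prod R V q x y) x = b y x"
proof -
  have qx: "q x \<in> carrier R" "b y x \<in> carrier R"
    using assms by (auto intro: q_closed)
  have "b (s_prod R V q x y) x = (b y x \<otimes> inv (q x)) \<otimes> (q x \<oplus> q x) \<ominus> b y x"
    using assms by (simp add: s_prod_def polar_diff_left polar_smult_left polar_self)
  also have "(b y x \<otimes> inv (q x)) \<otimes> (q x \<oplus> q x) = b y x \<oplus> b y x"
    using assms qx by (simp add: R.r_distr R.m_assoc)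
  also have "b y x \<oplus> b y x \<ominus> b y x = b y x"
    using qx by algebra
  finally show ?thesis .
qed

text \<open>Both sides expand to b(z,x) b(y,x) / q(x) - b(z,y), which is symmetric in y and
  z.\<close>

lemma s_prod_adjoint:
  assumes "x \<in> U" "y \<in> carrier V" "z \<in> carrier V"
  shows "b (s_prod R V q x z) y = b z (s_prod R V q x y)"
  using assms
  by (simp add: s_prod_def polar_diff_left polar_diff_right polar_smult_left polar_smult_right
      R.m_ac polar_sym[of x y])

lemma s_prod_diff:
  assumes "x \<in> U" "y \<in> carrier V" "z \<in> carrier V"
  shows "s_prod R V q x (y \<ominus>\<^bsub>V\<^esub> z) = s_prod R V q x y \<ominus>\<^bsub>V\<^esub> s_prod R V q x z"
  using assms
  by (simp add: s_prod_def polar_add_left polar_minus_left M.minus_eq R.l_distr R.l_minus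
      smult_l_distr smult_l_minus M.minus_add M.a_ac)

lemma s_prod_smult:
  assumes "x \<in> U" "y \<in> carrier V" "l \<in> carrier R"
  shows "s_prod R V q x (l \<odot>\<^bsub>V\<^esub> y) = l \<odot>\<^bsub>V\<^esub> s_prod R V q x y"
  using assms
  by (simp add: s_prod_def polar_smult_left smult_minus_distr smult_assoc1[symmetric] R.m_assoc)

text \<open>The polar form and the vector x each contribute one factor l, and the denominator
  contributes l^2.\<close>

lemma s_prod_smult_left:
  assumes "x \<in> U" "y \<in> carrier V" "l \<in> Units R"
  shows "s_prod R V q (l \<odot>\<^bsub>V\<^esub> x) y = s_prod R V q x y"
proof -
  have l: "l \<in> carrier R" using assms by (simp add: R.Units_closed)
  have "b y (l \<odot>\<^bsub>V\<^esub> x) \<otimes> inv (q (l \<odot>\<^bsub>V\<^esub> x)) \<otimes> l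
      = (l \<otimes> inv l) \<otimes> (l \<otimes> inv l) \<otimes> (b y x \<otimes> inv (q x))"
    using assms l
    by (simp add: polar_smult_right q_smult numeral_2_eq_2 R.inv_mult_Units R.m_ac
        del: R.Units_r_inv R.Units_l_inv)
  also have "\<dots> = b y x \<otimes> inv (q x)" using assms by simp
  finally show ?thesis
    using assms l unit_vectors_q[OF smult_unit_vectors[of l x]]
    by (simp add: s_prod_def smult_assoc1[symmetric])
qed

text \<open>With k = b(y,x)/q(x), the coefficient for the second application is again k, leaving k x
  - (k x - y).\<close>

lemma s_prod_invol:
  assumes "x \<in> U" "y \<in> carrier V"
  shows "s_prod R V q x (s_prod R V q x y) = y"
  unfolding s_prod_def[of R V q x "s_prod R V q x y"] polar_s_prod_self[OF assms]
  using assms by (simp add: s_prod_def M.minus_minus_cancel)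

lemma reflection_space_s_prod: "reflection_space U (s_prod R V q)"
proof
  show "s_prod R V q x y \<in> U" if "x \<in> U" "y \<in> U" for x y
    using that by (simp add: unit_vectorsI q_s_prod)
  show "s_prod R V q x x = x" if "x \<in> U" for x
    using that
    by (simp add: s_prod_def polar_self R.l_distr R.Units_closed smult_l_distr
        M.minus_eq M.a_assoc M.r_neg)
  show "s_prod R V q x (s_prod R V q x y) = y" if "x \<in> U" "y \<in> U" for x y
    using that by (simp add: s_prod_invol)
  show "s_prod R V q x (s_prod R V q y (s_prod R V q x z)) = s_prod R V q (s_prod R V q x y) z"
    if "x \<in> U" "y \<in> U" "z \<in> U" for x y z
  proof -
    \<comment> \<open>This is the coefficient of y when s_y is applied to s_x(z). Only s_y gets
      expanded; s_x is then moved inside by linearity and cancels against the inner s_x.\<close>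
    define c where "c = b (s_prod R V q x z) y \<otimes> inv (q y)"
    have c: "c \<in> carrier R" using that by (simp add: c_def)
    have "s_prod R V q x (s_prod R V q y (s_prod R V q x z))
        = s_prod R V q x (c \<odot>\<^bsub>V\<^esub> y \<ominus>\<^bsub>V\<^esub> s_prod R V q x z)"
      by (simp add: s_prod_def[of R V q y] c_def)
    also have "\<dots> = c \<odot>\<^bsub>V\<^esub> s_prod R V q x y \<ominus>\<^bsub>V\<^esub> z"
      using that c by (simp add: s_prod_diff s_prod_smult s_prod_invol)
    \<comment> \<open>Self-adjointness turns the numerator of \<open>c\<close> into b(z, s_x(y)),
      and isometry turns its denominator into q(s_x(y)), so \<open>c\<close> is exactly the
      coefficient required by the reflection in s_x(y).\<close>
    also have "\<dots> = s_prod R V q (s_prod R V q x y) z"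
      using that by (simp add: s_prod_def[of R V q "s_prod R V q x y"] c_def s_prod_adjoint q_s_prod)
    finally show ?thesis .
  qed
qed

section \<open>Rescaling a reflection space by quotients of values of q\<close>

lemma reflection_space_rescale:
  assumes "reflection_space U p"
    and q_p: "\<And>x y. x \<in> U \<Longrightarrow> y \<in> U \<Longrightarrow> q (p x y) = q y"
    and p_smult: "\<And>l x y. l \<in> Units R \<Longrightarrow> x \<in> U \<Longrightarrow> y \<in> U \<Longrightarrow>
      p x (l \<odot>\<^bsub>V\<^esub> y) = l \<odot>\<^bsub>V\<^esub> p x y"
    and p_smult_left: "\<And>l x y. l \<in> Units R \<Longrightarrow> x \<in> U \<Longrightarrow> y \<in> U \<Longrightarrow>
      p (l \<odot>\<^bsub>V\<^esub> x) y = p x y"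
  shows "reflection_space U (\<lambda>x y. (q x \<otimes> inv (q y)) \<odot>\<^bsub>V\<^esub> p x y)"
proof -
  interpret p: reflection_space U p by fact
  define t where "t x y = (q x \<otimes> inv (q y)) \<odot>\<^bsub>V\<^esub> p x y" for x y
  have t_closed: "t x y \<in> U" if "x \<in> U" "y \<in> U" for x y
    using that by (simp add: t_def smult_unit_vectors p.closed)
  \<comment> \<open>Since \<open>p\<close> preserves q, only the square of the scalar q(x)/q(y)
    matters, and one factor 1/q(y) cancels.\<close>
  have q_t: "q (t x y) = q x \<otimes> q x \<otimes> inv (q y)" if "x \<in> U" "y \<in> U" for x y
  proof -
    have "q (t x y) = (q x \<otimes> inv (q y)) \<otimes> (q x \<otimes> inv (q y)) \<otimes> q y"
      using that by (simp add: t_def q_smult q_p p.closed R.Units_closed numeral_2_eq_2)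
    also have "\<dots> = q x \<otimes> q x \<otimes> inv (q y) \<otimes> (inv (q y) \<otimes> q y)"
      using that by (simp add: R.m_ac R.Units_closed del: R.Units_l_inv R.Units_r_inv)
    also have "\<dots> = q x \<otimes> q x \<otimes> inv (q y)"
      using that by (simp add: R.Units_closed)
    finally show ?thesis .
  qed
  \<comment> \<open>The scalar is q(x)/q(t y z), with q(t y z) = q(y)^2/q(z), times the factor
    q(y)/q(z) pulled out of p x.\<close>
  have t_t: "t x (t y z) = (q x \<otimes> (inv (q y) \<otimes> inv (q y) \<otimes> q z) \<otimes> (q y \<otimes> inv (q z)))
      \<odot>\<^bsub>V\<^esub> p x (p y z)" if "x \<in> U" "y \<in> U" "z \<in> U" for x y z
    using that
    by (simp add: t_def[of x] q_t R.inv_mult_Units)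
       (simp add: t_def p_smult p.closed smult_assoc1[symmetric] R.Units_closed)
  \<comment> \<open>After cancellation the scalar no longer depends on z. For y = x it is 1, so (S2)
    for \<open>t\<close> reduces to (S2) for \<open>p\<close>.\<close>
  have t_t': "t x (t y z) = (q x \<otimes> inv (q y)) \<odot>\<^bsub>V\<^esub> p x (p y z)"
    if "x \<in> U" "y \<in> U" "z \<in> U" for x y z
  proof -
    have "q x \<otimes> (inv (q y) \<otimes> inv (q y) \<otimes> q z) \<otimes> (q y \<otimes> inv (q z))
        = (q x \<otimes> inv (q y)) \<otimes> ((q y \<otimes> inv (q y)) \<otimes> (q z \<otimes> inv (q z)))"
      using that by (simp add: R.m_ac R.Units_closed del: R.Units_l_inv R.Units_r_inv)
    also have "\<dots> = q x \<otimes> inv (q y)" using that by (simp add: R.Units_closed)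
    finally show ?thesis using t_t[OF that] by simp
  qed
  have "reflection_space U t"
  proof
    show "t x y \<in> U" if "x \<in> U" "y \<in> U" for x y using that by (rule t_closed)
    show "t x x = x" if "x \<in> U" for x using that by (simp add: t_def p.S1)
    show "t x (t x y) = y" if "x \<in> U" "y \<in> U" for x y
      using that by (simp add: t_t' p.S2)
    show "t x (t y (t x z)) = t (t x y) z" if "x \<in> U" "y \<in> U" "z \<in> U" for x y z
    proof -
      have "t x (t y (t x z)) = (q x \<otimes> inv (q y)) \<odot>\<^bsub>V\<^esub> p x (p y (t x z))"
        using that by (intro t_t' t_closed)
      also have "\<dots> = (q x \<otimes> inv (q y)) \<odot>\<^bsub>V\<^esub> ((q x \<otimes> inv (q z)) \<odot>\<^bsub>V\<^esub> p x (p y (p x z)))"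
        using that by (simp add: t_def p_smult p.closed)
      \<comment> \<open>The two scalars multiply to q(x)^2 / (q(y) q(z)), which is q(t x y)/q(z) by
        \<open>q_t\<close>.\<close>
      also have "\<dots> = (q (t x y) \<otimes> inv (q z)) \<odot>\<^bsub>V\<^esub> p (p x y) z"
        using that
        by (simp add: q_t p.S3 p.closed smult_assoc1[symmetric] R.Units_closed R.m_ac)
      \<comment> \<open>Here t x y is a unit multiple of p x y, so both span the same line.\<close>
      also have "p (p x y) z = p (t x y) z"
        using that by (simp add: t_def p_smult_left p.closed)
      finally show ?thesis by (simp add: t_def[of "t x y"])
    qed
  qed
  then show ?thesis by (simp add: t_def[abs_def])
qed

section \<open>The products j and sigma as rescalings\<close>

lemma reflection_space_j_prod: "reflection_space U (j_prod R V q)"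
proof -
  have "reflection_space U (\<lambda>x y. y)" by unfold_locales simp_all
  then show ?thesis
    using reflection_space_rescale[of "\<lambda>x y. y"] by (simp add: j_prod_def[abs_def])
qed

text \<open>In the coefficient of x, the factor q(x) cancels the denominator of s_x.\<close>

lemma sigma_prod_eq_rescale:
  assumes "x \<in> U" "y \<in> U"
  shows "sigma_prod R V q x y = (q x \<otimes> inv (q y)) \<odot>\<^bsub>V\<^esub> s_prod R V q x y"
proof -
  have "q x \<otimes> inv (q y) \<otimes> (b y x \<otimes> inv (q x)) = (b y x \<otimes> inv (q y)) \<otimes> (q x \<otimes> inv (q x))"
    using assms by (simp add: R.m_ac R.Units_closed del: R.Units_l_inv R.Units_r_inv)
  also have "\<dots> = b y x \<otimes> inv (q y)" using assms by simp
  finally show ?thesis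
    using assms
    by (simp add: sigma_prod_def s_prod_def smult_minus_distr smult_assoc1[symmetric] R.Units_closed)
qed

lemma reflection_space_sigma_prod: "reflection_space U (sigma_prod R V q)"
proof (rule reflection_space_cong)
  show "reflection_space U (\<lambda>x y. (q x \<otimes> inv (q y)) \<odot>\<^bsub>V\<^esub> s_prod R V q x y)"
    by (intro reflection_space_rescale reflection_space_s_prod)
       (simp_all add: q_s_prod s_prod_smult s_prod_smult_left R.Units_closed)
qed (rule sigma_prod_eq_rescale)

section \<open>Restriction to spheres\<close>

context
  fixes r assumes r: "r \<in> Units R"
begin

lemma q_sphere_subset: "q_sphere V q r \<subseteq> U"
  using r by (auto simp: q_sphere_def intro: unit_vectorsI)

lemma j_prod_sphere:
  "x \<in> q_sphere V q r \<Longrightarrow> y \<in> q_sphere V q r \<Longrightarrow> j_prod R V q x y = y"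
  using r by (simp add: q_sphere_def j_prod_def)

lemma sigma_prod_sphere:
  assumes "x \<in> q_sphere V q r" "y \<in> q_sphere V q r"
  shows "sigma_prod R V q x y = s_prod R V q x y"
proof -
  have U: "x \<in> U" "y \<in> U" using assms q_sphere_subset by blast+
  have "q x = r" "q y = r" using assms by (simp_all add: q_sphere_def)
  then show ?thesis using U r by (simp add: sigma_prod_eq_rescale)
qed

lemma s_prod_sphere_closed:
  assumes "x \<in> q_sphere V q r" "y \<in> q_sphere V q r"
  shows "s_prod R V q x y \<in> q_sphere V q r"
proof -
  have "x \<in> U" using assms q_sphere_subset by blast
  then show ?thesis using assms by (simp add: q_sphere_def q_s_prod)
qed

end

end

theorem theorem2p4:
  fixes R :: "('a, 'r) ring_scheme"
    and V :: "('a, 'v, 'm) module_scheme"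
    and q :: "'v \<Rightarrow> 'a"
  assumes "quadratic_space R V q"
    and "unit_vectors R V q \<noteq> {}"
  shows "reflection_space (unit_vectors R V q) (s_prod R V q) \<and>
    reflection_space (unit_vectors R V q) (j_prod R V q) \<and>
    reflection_space (unit_vectors R V q) (sigma_prod R V q) \<and>
    (\<forall>r\<in>Units R.
      sub_reflection_space (q_sphere V q r) (unit_vectors R V q) (s_prod R V q) \<and>
      sub_reflection_space (q_sphere V q r) (unit_vectors R V q) (j_prod R V q) \<and>
      sub_reflection_space (q_sphere V q r) (unit_vectors R V q) (sigma_prod R V q) \<and>
      (\<forall>x\<in>q_sphere V q r. \<forall>y\<in>q_sphere V q r.
        j_prod R V q x y = y \<and> s_prod R V q x y = sigma_prod R V q x y))"
proof -
  interpret quadratic_space R V q by fact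
  \<comment> \<open>Stability of a sphere comes down to s, which preserves q: on the sphere j
    returns its second argument and sigma agrees with s.\<close>
  show ?thesis
    by (simp add: sub_reflection_space_def reflection_space_s_prod reflection_space_j_prod
        reflection_space_sigma_prod q_sphere_subset j_prod_sphere sigma_prod_sphere
        s_prod_sphere_closed)
qed

end
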